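(* For each non-negative integer $m$, $$\lim_{q\uparrow 1}\zeta_q(-m)=-\frac{B_{m+1}}{m+1},$$ where, for $0<q<1$, $\zeta_q(-m):=\lim_{s\to -m}\zeta_q(s)$ is the limiting value at $s=-m$ of the ($q$-analogue) function $\zeta_q(s)$, and $B_k$ denotes the $k$-th Bernoulli number normalized by $B_1=\tfrac12$.
   Context: For $0<q<1$ and an integer $n\ge1$ put $[n]_q=(1-q^n)/(1-q)>0$; powers of positive reals are $x^s=e^{s\log x}$ with real logarithm. For $\mathrm{Re}(s)>1$ define $$\zeta_q(s)=\sum_{n=1}^\infty\frac{q^{n(s-1)}}{[n]_q^s},$$ which converges absolutely there, and denote by the same symbol its meromorphic continuation to $s\in\mathbf{C}$, which is given by $$\zeta_q(s)=(1-q)^s\sum_{r=0}^\infty\binom{s+r-1}{r}\frac{q^{s+r-1}}{1-q^{s+r-1}},\qquad \binom{s+r-1}{r}=\frac{s(s+1)\cdots(s+r-1)}{r!}.$$ For each integer $m\ge0$ the limit $\lim_{s\to-m}\zeta_q(s)$ exists and is finite (although the individual term $r=m+1$ of the series is of indeterminate form at $s=-m$), and it is denoted $\zeta_q(-m)$. The Bernoulli numbers are defined by $$\frac{te^t}{e^t-1}=\sum_{k=0}^\infty B_k\frac{t^k}{k!},$$ so $B_0=1$, $B_1=\frac12$, $B_2=\frac16$, $B_3=0$, $B_4=-\frac1{30}$, etc. *)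

theory Defs
  imports "HOL-Complex_Analysis.Complex_Analysis"
begin

definition qbracket :: "real \<Rightarrow> nat \<Rightarrow> real" where
  "qbracket q n = (1 - q ^ n) / (1 - q)"

(* The series starts at n = 1, hence the Suc.  For a positive real base, powr on the complex
   numbers is exp (s * ln x) with the real logarithm. *)
definition qzeta_series :: "real \<Rightarrow> complex \<Rightarrow> complex" where
  "qzeta_series q s =
     (\<Sum>n. of_real q powr (of_nat (Suc n) * (s - 1)) / of_real (qbracket q (Suc n)) powr s)"

(* The meromorphic continuation to the whole plane of the series, which converges for Re s > 1.
   The adverb "nicely" removes all removable singularities and fixes the value at a pole to be 0;
   without it the continuation would be determined only up to its values on a discrete set. *)
definition qzeta :: "real \<Rightarrow> complex \<Rightarrow> complex" where
  "qzeta q = (THE f. f nicely_meromorphic_on UNIV \<and> (\<forall>s. Re s > 1 \<longrightarrow> f s = qzeta_series q s))"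

(* Convention with B_1 = +1/2: the generating function is t * exp t / (exp t - 1).  Numerator and
   denominator both vanish to order exactly 1 at t = 0, so the fps quotient is exact. *)
definition bernoulli :: "nat \<Rightarrow> real" where
  "bernoulli k = fact k * fps_nth (fps_X * fps_exp 1 / (fps_exp 1 - 1)) k"

end

(* Expanding (1 - q^n)^(-s) by the binomial series and summing over n first gives the meromorphic
   continuation of qzeta as a series of terms qterm q r.  At s = -m the factor pochhammer s r kills
   all terms with r > m + 1, while in the term r = m + 1 its zero cancels the pole of
   q^(s+m) / (1 - q^(s+m)) and contributes a multiple of 1 / ln q.  With q = exp (-t) the resulting
   finite sum is an m-th finite difference of g(kt) / (kt) in k, where g x = x e^x / (e^x - 1) is the
   generating function of the Bernoulli numbers.  The constant term of g contributes exactly minus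
   the 1 / ln q term, the Taylor terms of order 1, ..., m are annihilated, and the term of order
   m + 1 yields the limit as t tends to 0. *)
theory Submission
  imports Defs
begin

section \<open>The terms of the continued series and their bounds\<close>

definition qterm :: "real \<Rightarrow> nat \<Rightarrow> complex \<Rightarrow> complex" where
  "qterm q r s = pochhammer s r / fact r *
     (of_real q powr (s + of_nat r - 1) / (1 - of_real q powr (s + of_nat r - 1)))"

text \<open>Since \<open>x / 0 = 0\<close>, a term takes the value 0 where its denominator vanishes.
  At s = -m the term r = m + 1 is thus 0 instead of its limit, so this function has the right values
  only off a discrete set; \<open>remove_sings\<close> repairs this in
  \<open>qzeta_eq\<close>.\<close>

definition qcont :: "real \<Rightarrow> complex \<Rightarrow> complex" where
  "qcont q s = of_real (1 - q) powr s * (\<Sum>r. qterm q r s)"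

lemma norm_pochhammer_le:
  fixes s :: "'a :: real_normed_field"
  assumes "norm s \<le> R"
  shows "norm (pochhammer s r) \<le> pochhammer R r"
proof (induction r)
  case (Suc r)
  have "norm (s + of_nat r) \<le> R + of_nat r"
    using norm_triangle_ineq[of s "of_nat r"] assms by simp
  moreover have "0 \<le> R" using assms norm_ge_zero order_trans by blast
  ultimately show ?case
    unfolding pochhammer_Suc norm_mult using Suc
    by (intro mult_mono) (auto intro: order_trans[OF norm_ge_zero Suc])
qed auto

lemma analytic_pochhammer: "(\<lambda>s :: complex. pochhammer s r) analytic_on A"
  by (induction r) (auto simp: pochhammer_Suc intro!: analytic_intros)

lemma tendsto_pochhammer:
  fixes l :: "'a :: real_normed_field"
  assumes "(f \<longlongrightarrow> l) F"
  shows "((\<lambda>x. pochhammer (f x) r) \<longlongrightarrow> pochhammer l r) F"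
  by (induction r) (auto simp: pochhammer_Suc intro!: tendsto_intros assms)

text \<open>This is the binomial series with exponent -s at -z: the sign (-1)^r in the generalized
  binomial coefficient cancels the one in (-z)^r.\<close>

lemma pochhammer_series:
  fixes s z :: complex
  assumes "norm z < 1"
  shows "(\<lambda>r. pochhammer s r / fact r * z ^ r) sums ((1 - z) powr (- s))"
proof -
  have "(\<lambda>r. ((- s) gchoose r) * (- z) ^ r) sums (1 + - z) powr (- s)"
    by (rule gen_binomial_complex) (use assms in simp)
  moreover have "((- s) gchoose r) * (- z) ^ r = pochhammer s r / fact r * z ^ r" for r
    by (simp add: gbinomial_pochhammer power_minus[of z] mult_ac)
  ultimately show ?thesis by simp
qed

lemma summable_pochhammer:
  fixes q R :: real
  assumes "\<bar>q\<bar> < 1"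
  shows "summable (\<lambda>r. pochhammer R r / fact r * q ^ r)"
proof -
  have "(\<lambda>r. ((- R) gchoose r) * (- q) ^ r) sums (1 + - q) powr (- R)"
    by (rule gen_binomial_real) (use assms in simp)
  moreover have "((- R) gchoose r) * (- q) ^ r = pochhammer R r / fact r * q ^ r" for r
    by (simp add: gbinomial_pochhammer power_minus[of q] mult_ac)
  ultimately show ?thesis by (simp add: sums_iff)
qed

lemma norm_of_real_powr:
  assumes "0 < q"
  shows "norm (of_real q powr (s :: complex)) = q powr Re s"
  using assms by (simp add: norm_powr_real_powr)

lemma norm_of_real_powr_less_1:
  assumes "0 < q" "q < 1" "0 < Re s"
  shows "norm (of_real q powr (s :: complex)) < 1"
  using assms powr_less_mono'[of q 0 "Re s"] by (simp add: norm_of_real_powr)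

lemma analytic_of_real_powr:
  assumes "0 < a"
  shows "(\<lambda>s. of_real a powr s) analytic_on A"
  using assms by (intro analytic_intros) auto

text \<open>The majorant is a constant times the binomial series of (1 - q) powr (-R), uniformly in
  s: the bound on the norm of s yields the factor q^r, and \<delta> keeps the denominator away from
  0. The first bound concerns the sum over n of the norms in the double series and serves to
  interchange summations; the second follows from it by the reverse triangle inequality and serves
  for the M-test.\<close>

lemma norm_qterm_le:
  assumes q: "0 < q" "q < 1" and R: "norm s \<le> R" and \<delta>: "0 < \<delta>" "\<delta> \<le> Re s + real r - 1"
  shows "norm (pochhammer s r / fact r) * (q powr (Re s + real r - 1) / (1 - q powr (Re s + real r - 1)))
           \<le> q powr (- R - 1) / (1 - q powr \<delta>) * (pochhammer R r / fact r * q ^ r)"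
    and "norm (qterm q r s) \<le> q powr (- R - 1) / (1 - q powr \<delta>) * (pochhammer R r / fact r * q ^ r)"
proof -
  define x where "x = q powr (Re s + real r - 1)"
  define z where "z = of_real q powr (s + of_nat r - 1)"
  have nz: "norm z = x"
    unfolding z_def x_def using q by (simp add: norm_of_real_powr)
  have x\<delta>: "x \<le> q powr \<delta>"
    unfolding x_def using q \<delta> by (intro powr_mono') auto
  have \<delta>1: "q powr \<delta> < 1"
    using q \<delta> powr_less_mono'[of q 0 \<delta>] by simp
  have R0: "0 \<le> R" using R norm_ge_zero order_trans by blast
  have "x \<le> q powr (- R - 1 + real r)"
    unfolding x_def using q R abs_Re_le_cmod[of s] by (intro powr_mono') auto
  also have "\<dots> = q powr (- R - 1) * q ^ r"
    using q by (simp add: powr_add powr_realpow)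
  finally have xR: "x \<le> q powr (- R - 1) * q ^ r" .
  have x0: "0 \<le> x" unfolding x_def by simp
  have p0: "0 \<le> pochhammer R r"
    by (rule order_trans[OF norm_ge_zero norm_pochhammer_le[OF R]])
  have "x / (1 - x) \<le> q powr (- R - 1) * q ^ r / (1 - q powr \<delta>)"
    using x0 xR x\<delta> \<delta>1 q by (intro frac_le) auto
  then have "norm (pochhammer s r / fact r) * (x / (1 - x)) \<le>
      pochhammer R r / fact r * (q powr (- R - 1) * q ^ r / (1 - q powr \<delta>))"
    using norm_pochhammer_le[OF R, of r] x0 x\<delta> \<delta>1 p0
    by (intro mult_mono) (auto simp: norm_divide divide_right_mono)
  then show *: "norm (pochhammer s r / fact r) * (q powr (Re s + real r - 1) / (1 - q powr (Re s + real r - 1)))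
           \<le> q powr (- R - 1) / (1 - q powr \<delta>) * (pochhammer R r / fact r * q ^ r)"
    unfolding x_def by (simp add: mult_ac)
  have "1 - x \<le> norm (1 - z)"
    using norm_triangle_ineq2[of 1 z] nz by simp
  then have "norm (z / (1 - z)) \<le> x / (1 - x)"
    unfolding norm_divide nz using x0 x\<delta> \<delta>1 by (intro frac_le) auto
  then have "norm (qterm q r s) \<le> norm (pochhammer s r / fact r) * (x / (1 - x))"
    unfolding qterm_def norm_mult z_def by (intro mult_left_mono) auto
  with * show "norm (qterm q r s) \<le> q powr (- R - 1) / (1 - q powr \<delta>) * (pochhammer R r / fact r * q ^ r)"
    unfolding x_def by linarith
qed

lemma summable_qterm:
  assumes q: "0 < q" "q < 1"
  shows "summable (\<lambda>r. qterm q r s)"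
proof (rule summable_comparison_test_ev)
  show "\<forall>\<^sub>F r in sequentially. norm (qterm q r s)
      \<le> q powr (- norm s - 1) / (1 - q powr 1) * (pochhammer (norm s) r / fact r * q ^ r)"
    \<comment> \<open>From this index on, Re s + r - 1 is at least 1, so the bound applies with
      \<delta> = 1.\<close>
    using eventually_ge_at_top[of "nat \<lceil>norm s\<rceil> + 2"]
  proof eventually_elim
    case (elim r)
    then show ?case
      using abs_Re_le_cmod[of s] q
      by (intro norm_qterm_le) (auto, linarith)
  qed
  show "summable (\<lambda>r. q powr (- norm s - 1) / (1 - q powr 1) * (pochhammer (norm s) r / fact r * q ^ r))"
    using q by (intro summable_mult summable_pochhammer) auto
qed

lemma analytic_qterm:
  assumes q: "0 < q" "q < 1" and "Re s + real r > 1"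
  shows "qterm q r analytic_on {s}"
proof -
  have "norm (of_real q powr (s + of_nat r - 1)) < 1"
    using assms by (intro norm_of_real_powr_less_1) auto
  then have "1 - of_real q powr (s + of_nat r - 1) \<noteq> 0" by auto
  then show ?thesis
    unfolding qterm_def using q
    by (intro analytic_intros analytic_pochhammer) auto
qed

lemma meromorphic_qterm:
  assumes q: "0 < q"
  shows "qterm q r meromorphic_on A"
proof -
  have "(\<lambda>s. of_real q powr (s + of_nat r - 1)) analytic_on A"
    using q by (intro analytic_intros) auto
  then show ?thesis
    unfolding qterm_def
    by (intro meromorphic_intros analytic_on_imp_meromorphic_on analytic_pochhammer) auto
qed

section \<open>Meromorphy of the continued series\<close>

text \<open>The denominator of term r vanishes only on the line Re s = 1 - r. For r at least R + 2
  this line misses the ball, even with distance enough for \<delta> = 1, and the Weierstrass test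
  gives uniform convergence.\<close>

lemma holomorphic_qtail:
  assumes q: "0 < q" "q < 1" and N: "real N \<ge> R + 2"
  shows "(\<lambda>s. \<Sum>r. qterm q (r + N) s) holomorphic_on ball 0 R"
proof (rule holomorphic_uniform_sequence)
  define M where "M r = q powr (- R - 1) / (1 - q powr 1) * (pochhammer R r / fact r * q ^ r)" for r
  show "(\<lambda>s. \<Sum>r<n. qterm q (r + N) s) holomorphic_on ball 0 R" for n
  proof (intro holomorphic_on_sum analytic_imp_holomorphic)
    fix r
    show "qterm q (r + N) analytic_on ball 0 R"
    proof (subst analytic_on_analytic_at, intro ballI analytic_qterm q)
      fix s :: complex assume "s \<in> ball 0 R"
      then show "1 < Re s + real (r + N)"
        using N abs_Re_le_cmod[of s] by auto
    qed
  qed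
  have unif: "uniform_limit (ball 0 R) (\<lambda>n s. \<Sum>r<n. qterm q (r + N) s)
               (\<lambda>s. \<Sum>r. qterm q (r + N) s) sequentially"
  proof (rule Weierstrass_m_test)
    fix r and s :: complex assume "s \<in> ball 0 R"
    then show "norm (qterm q (r + N) s) \<le> M (r + N)"
      unfolding M_def using N abs_Re_le_cmod[of s] q
      by (intro norm_qterm_le) auto
  next
    show "summable (\<lambda>r. M (r + N))"
      unfolding M_def using q
      by (subst summable_iff_shift) (intro summable_mult summable_pochhammer, auto)
  qed
  fix x assume "x \<in> ball (0 :: complex) R"
  then obtain d where "d > 0" "cball x d \<subseteq> ball 0 R"
    using open_contains_cball[of "ball 0 R"] by blast
  then show "\<exists>d>0. cball x d \<subseteq> ball 0 R \<and> uniform_limit (cball x d)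
     (\<lambda>n s. \<Sum>r<n. qterm q (r + N) s) (\<lambda>s. \<Sum>r. qterm q (r + N) s) sequentially"
    using unif uniform_limit_on_subset by blast
qed simp

lemma qcont_split:
  assumes q: "0 < q" "q < 1"
  shows "qcont q s = of_real (1 - q) powr s * ((\<Sum>r<N. qterm q r s) + (\<Sum>r. qterm q (r + N) s))"
  unfolding qcont_def using suminf_split_initial_segment[OF summable_qterm[OF q], of s N]
  by (simp add: add.commute)

lemma analytic_qtail:
  assumes q: "0 < q" "q < 1" and N: "real N \<ge> norm s + 3"
  shows "(\<lambda>s. \<Sum>r. qterm q (r + N) s) analytic_on {s}"
proof -
  have "(\<lambda>s. \<Sum>r. qterm q (r + N) s) holomorphic_on ball 0 (norm s + 1)"
    using N by (intro holomorphic_qtail q) auto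
  then have "(\<lambda>s. \<Sum>r. qterm q (r + N) s) analytic_on ball 0 (norm s + 1)"
    by (simp add: analytic_on_open)
  then show ?thesis
    by (rule analytic_on_subset) auto
qed

text \<open>Near any given point only finitely many terms can be singular; the tail behind them is
  analytic there.\<close>

lemma meromorphic_qcont:
  assumes q: "0 < q" "q < 1"
  shows "qcont q meromorphic_on A"
proof (subst meromorphic_on_meromorphic_at, intro ballI)
  fix s :: complex
  obtain N :: nat where N: "real N \<ge> norm s + 3"
    using real_arch_simple by blast
  show "qcont q meromorphic_on {s}"
    unfolding qcont_split[OF q, abs_def, of N]
    by (intro meromorphic_intros analytic_on_imp_meromorphic_on[OF analytic_qtail] meromorphic_qterm q N
          analytic_on_imp_meromorphic_on[OF analytic_of_real_powr]) (use q in auto)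
qed

lemma analytic_qcont:
  assumes q: "0 < q" "q < 1" and s: "Re s > 1"
  shows "qcont q analytic_on {s}"
proof -
  obtain N :: nat where N: "real N \<ge> norm s + 3"
    using real_arch_simple by blast
  have "qterm q r analytic_on {s}" for r
    using s by (intro analytic_qterm q) auto
  then show ?thesis
    unfolding qcont_split[OF q, abs_def, of N] using q
    by (intro analytic_intros analytic_qtail analytic_of_real_powr q N) auto
qed

section \<open>Agreement with the defining series for Re s > 1\<close>

lemma qzeta_series_eq_qcont:
  assumes q: "0 < q" "q < 1" and s: "Re s > 1"
  shows "qzeta_series q s = qcont q s"
proof -
  define z where "z r = of_real q powr (s + of_nat r - 1)" for r
  \<comment> \<open>Row sums (over n, geometric) give the terms \<open>qterm q r s\<close>; column
    sums (over r, binomial) give the terms of the defining series up to the factor (1 - q) powr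
    s.\<close>
  define f where "f = (\<lambda>(r, n). pochhammer s r / fact r * z r ^ Suc n)"
  have z1: "norm (z r) < 1" for r
    unfolding z_def using q s by (intro norm_of_real_powr_less_1) auto
  \<comment> \<open>Regrouping the exponent (n + 1)(s + r - 1) isolates an r-th power, so that the
    column becomes a binomial series at q^(n + 1).\<close>
  have z_add: "z r ^ Suc n = of_real q powr (of_nat (Suc n) * (s - 1)) * of_real (q ^ Suc n) ^ r" for r n
  proof -
    have "z r = of_real q powr ((s - 1) + of_nat r)"
      unfolding z_def by (simp add: algebra_simps)
    also have "\<dots> = of_real q powr (s - 1) * of_real q ^ r"
      using q by (simp only: powr_add) (simp add: powr_nat')
    finally have "z r ^ Suc n = (of_real q powr (s - 1)) ^ Suc n * of_real q ^ (r * Suc n)"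
      by (simp only: power_mult_distrib power_mult)
    also have "(of_real q powr (s - 1)) ^ Suc n = of_real q powr (of_nat (Suc n) * (s - 1))"
      using q by (simp only: powr_def) (simp add: exp_of_nat_mult[symmetric] mult_ac del: power_Suc of_nat_Suc)
    also have "of_real q ^ (r * Suc n) = (of_real (q ^ Suc n) :: complex) ^ r"
      by (simp only: of_real_power power_mult[symmetric] mult.commute)
    finally show ?thesis .
  qed
  have sums_z: "(\<lambda>n. w ^ Suc n) sums (w / (1 - w))" if "norm w < 1" for w :: "'a :: real_normed_field"
    using sums_mult[OF geometric_sums[OF that], of w] by simp
  define g where "g r = norm (pochhammer s r / fact r) * (norm (z r) / (1 - norm (z r)))" for r
  have norm_hs: "((\<lambda>n. norm (f (r, n))) has_sum g r) UNIV" for r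
  proof (rule sums_nonneg_imp_has_sum)
    show "(\<lambda>n. norm (f (r, n))) sums g r"
      unfolding f_def g_def prod.case norm_mult norm_power
      using z1[of r] by (intro sums_mult sums_z) simp
  qed simp
  \<comment> \<open>As Re s > 1, the choice \<delta> = Re s - 1 works for every row at once.
    Summability of these row sums of norms makes the double family absolutely summable.\<close>
  have "summable g"
  proof (rule summable_comparison_test_ev)
    show "\<forall>\<^sub>F r in sequentially. norm (g r) \<le> q powr (- norm s - 1) / (1 - q powr (Re s - 1)) *
        (pochhammer (norm s) r / fact r * q ^ r)"
    proof (intro always_eventually allI)
      fix r
      have "norm (z r) = q powr (Re s + real r - 1)"
        unfolding z_def using q by (simp add: norm_of_real_powr)
      moreover have "norm (g r) = g r" unfolding g_def using z1[of r] by simp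
      ultimately show "norm (g r) \<le> q powr (- norm s - 1) / (1 - q powr (Re s - 1)) *
        (pochhammer (norm s) r / fact r * q ^ r)"
        using norm_qterm_le(1)[OF q order_refl, of "Re s - 1" s r] s by (simp only: g_def)
    qed
    show "summable (\<lambda>r. q powr (- norm s - 1) / (1 - q powr (Re s - 1)) *
        (pochhammer (norm s) r / fact r * q ^ r))"
      using q by (intro summable_mult summable_pochhammer) auto
  qed
  then have "g summable_on UNIV"
    using z1 by (intro summable_nonneg_imp_summable_on) (auto simp: g_def less_imp_le)
  then have "(\<lambda>x. norm (f x)) summable_on (UNIV \<times> UNIV)"
    using norm_hs by (intro summable_on_SigmaI[where g = g]) auto
  then have "f summable_on (UNIV \<times> UNIV)"
    by (rule abs_summable_summable)
  then obtain S where S: "(f has_sum S) (UNIV \<times> UNIV)"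
    by (auto simp: summable_on_def)
  then have S': "((\<lambda>(n, r). f (r, n)) has_sum S) (UNIV \<times> UNIV)"
    using has_sum_swap by blast

  have rows: "((\<lambda>n. f (r, n)) has_sum qterm q r s) UNIV" for r
  proof (rule norm_summable_imp_has_sum)
    show "summable (\<lambda>n. norm (f (r, n)))"
      using norm_hs has_sum_imp_sums sums_summable by blast
    show "(\<lambda>n. f (r, n)) sums qterm q r s"
      unfolding f_def qterm_def prod.case z_def[symmetric]
      by (intro sums_mult sums_z z1)
  qed
  have "((\<lambda>r. qterm q r s) has_sum S) UNIV"
    by (rule has_sum_SigmaD[OF S]) (rule rows)
  then have 1: "(\<Sum>r. qterm q r s) = S"
    using has_sum_imp_sums sums_unique by blast

  define h where "h n = of_real q powr (of_nat (Suc n) * (s - 1)) * (1 - of_real (q ^ Suc n)) powr (- s)" for n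
  have cols: "((\<lambda>r. f (r, n)) has_sum h n) UNIV" for n
  proof -
    \<comment> \<open>Summability of the column is inherited from the double family; its value is
      then read off the ordered binomial series.\<close>
    have "(\<lambda>r. f (r, n)) summable_on UNIV"
      using summable_on_SigmaD1[of "\<lambda>n r. f (r, n)" UNIV "\<lambda>_. UNIV" n] S' by (auto simp: summable_on_def)
    moreover have "(\<lambda>r. f (r, n)) sums h n"
    proof -
      have "q ^ Suc n < 1" using q by (intro power_Suc_less_one) auto
      then have "norm (of_real (q ^ Suc n) :: complex) < 1"
        using q by (simp add: norm_power norm_mult del: of_real_power)
      from sums_mult[OF pochhammer_series[OF this, of s], of "of_real q powr (of_nat (Suc n) * (s - 1))"]
      show ?thesis
        unfolding f_def h_def prod.case z_add by (simp only: mult.left_commute)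
    qed
    ultimately show ?thesis
      by (metis has_sum_imp_sums has_sum_infsum sums_unique2)
  qed
  have "(h has_sum S) UNIV"
    by (rule has_sum_SigmaD[OF S']) (simp only: prod.case cols)
  then have "h sums S" by (rule has_sum_imp_sums)
  then have "(\<lambda>n. of_real (1 - q) powr s * h n) sums (of_real (1 - q) powr s * S)"
    by (rule sums_mult)
  \<comment> \<open>All bases are positive reals, so each power is an exponential of s times a real
    logarithm and no branch of the logarithm intervenes.\<close>
  moreover have "of_real (1 - q) powr s * h n =
      of_real q powr (of_nat (Suc n) * (s - 1)) / of_real (qbracket q (Suc n)) powr s" for n
  proof -
    have pos: "0 < 1 - q ^ Suc n" using q power_Suc_less_one[of q n] by simp
    have "of_real (qbracket q (Suc n)) powr s = exp (s * of_real (ln (1 - q ^ Suc n) - ln (1 - q)))"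
      unfolding qbracket_def using q pos
      by (simp add: powr_def Ln_of_real ln_div del: power_Suc of_real_divide of_real_diff)
    moreover have "(1 - of_real (q ^ Suc n)) powr (- s) = exp (- s * of_real (ln (1 - q ^ Suc n)))"
    proof -
      have "1 - of_real (q ^ Suc n) = (of_real (1 - q ^ Suc n) :: complex)" by simp
      then show ?thesis using pos by (simp only: powr_def) (simp add: Ln_of_real del: power_Suc of_real_diff)
    qed
    moreover have "of_real (1 - q) powr s = exp (s * of_real (ln (1 - q)))"
      using q by (simp add: powr_def Ln_of_real del: of_real_diff)
    moreover have "exp (s * of_real a) * (x * exp (- s * of_real b)) = x / exp (s * of_real (b - a))"
      for a b and x :: complex
      by (simp add: exp_diff exp_minus right_diff_distrib field_simps)
    ultimately show ?thesis
      unfolding h_def by (simp only:)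
  qed
  ultimately show ?thesis
    unfolding qzeta_series_def qcont_def 1 by (simp add: sums_iff)
qed

section \<open>Uniqueness of the continuation\<close>

text \<open>A meromorphic function on the plane is either 0 off a sparse set or nonzero off a sparse
  set; for f - g the open set U excludes the latter. Equality then extends to every point because a
  nicely meromorphic function is fixed at w by its values near w: it is its limit there, or 0 at a
  pole.\<close>

lemma nicely_meromorphic_unique:
  assumes f: "f nicely_meromorphic_on UNIV" and g: "g nicely_meromorphic_on UNIV"
    and U: "open U" "U \<noteq> {}" and eq: "\<And>s. s \<in> U \<Longrightarrow> f s = g s"
  shows "f = g"
proof
  fix w
  obtain z where z: "z \<in> U" using U by blast
  have mero: "(\<lambda>s. f s - g s) meromorphic_on UNIV"
    using f g by (intro meromorphic_intros) (auto simp: nicely_meromorphic_on_def)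
  have "eventually (\<lambda>s. f s - g s = 0) (at z)"
    using eventually_at_in_open'[OF U(1) z] by eventually_elim (use eq in auto)
  then have "\<not> eventually (\<lambda>s. f s - g s \<noteq> 0) (at z)"
    using eventually_elim2[of _ "at z" _ "\<lambda>_. False"] by fastforce
  then have "\<not> eventually (\<lambda>s. f s - g s \<noteq> 0) (cosparse UNIV)"
    using eventually_cosparse_imp_eventually_at[of _ UNIV z UNIV] by blast
  then have "eventually (\<lambda>s. f s - g s = 0) (cosparse UNIV)"
    using meromorphic_imp_constant_or_avoid[OF mero, of 0] by auto
  then have ev: "eventually (\<lambda>s. f s = g s) (at w)"
    using eventually_cosparse_imp_eventually_at[of "\<lambda>s. f s - g s = 0" UNIV w UNIV] by simp
  have rf: "remove_sings f w = f w" and rg: "remove_sings g w = g w"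
    using f g unfolding nicely_meromorphic_on_def
    by (metis UNIV_I remove_sings_at_pole remove_sings_eqI)+
  show "f w = g w"
    using remove_sings_cong[OF ev refl] rf rg by simp
qed

text \<open>For Re s > 1 \<open>qcont\<close> is analytic, so \<open>remove_sings\<close> leaves its
  values unchanged; elsewhere it produces the normalization that makes the described function
  unique.\<close>

lemma qzeta_eq:
  assumes q: "0 < q" "q < 1"
  shows "qzeta q = remove_sings (qcont q)"
  unfolding qzeta_def
proof (rule the_equality)
  show *: "remove_sings (qcont q) nicely_meromorphic_on UNIV \<and>
      (\<forall>s. 1 < Re s \<longrightarrow> remove_sings (qcont q) s = qzeta_series q s)"
    using analytic_qcont[OF q] meromorphic_qcont[OF q] qzeta_series_eq_qcont[OF q]
    by (auto intro: remove_sings_nicely_meromorphic)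
  fix f assume "f nicely_meromorphic_on UNIV \<and> (\<forall>s. 1 < Re s \<longrightarrow> f s = qzeta_series q s)"
  moreover have "{s. 1 < Re s} \<noteq> {}" by (auto intro!: exI[of _ 2])
  ultimately show "f = remove_sings (qcont q)"
    using * by (intro nicely_meromorphic_unique[of _ _ "{s. 1 < Re s}"]) (auto simp: open_halfspace_Re_gt)
qed

text \<open>The singularity at s is isolated, so \<open>remove_sings\<close> changes no value in a
  punctured neighbourhood, which is all that the limit sees.\<close>

lemma tendsto_qzeta:
  assumes q: "0 < q" "q < 1" and "qcont q \<midarrow>s\<rightarrow> l"
  shows "qzeta q \<midarrow>s\<rightarrow> l"
proof -
  have "isolated_singularity_at (qcont q) s"
    using meromorphic_qcont[OF q, of "{s}"] by (simp add: meromorphic_at_iff)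
  then have "eventually (\<lambda>w. qcont q w = qzeta q w) (at s)"
    using eventually_remove_sings_eq_at by (fastforce simp: qzeta_eq[OF q] eq_commute)
  with assms(3) show ?thesis by (rule Lim_transform_eventually)
qed

section \<open>The value at s = -m as a finite sum\<close>

text \<open>The last Pochhammer factor s + m is divided by 1 - q^(s+m), a difference quotient
  tending to -1 / ln q. The remaining factors tend to (-1)^m m! / (m+1)!.\<close>

lemma tendsto_qterm_exceptional:
  assumes q: "0 < q" "q < 1"
  shows "qterm q (m + 1) \<midarrow>- of_nat m\<rightarrow> of_real ((- 1) ^ (m + 1) / (real (m + 1) * ln q))"
proof -
  let ?m = "- of_nat m :: complex"
  define G where "G s = (of_real q :: complex) powr (s + of_nat m)" for s
  have m: "1 + of_nat m \<noteq> (0 :: complex)"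
    by (metis of_nat_Suc of_nat_eq_0_iff nat.distinct(1))
  have "(G has_field_derivative G ?m * of_real (ln q)) (at ?m)"
    using q unfolding G_def powr_def by (auto intro!: derivative_eq_intros simp: Ln_of_real)
  then have "((\<lambda>s. (G s - 1) / (s + of_nat m)) \<longlongrightarrow> of_real (ln q)) (at ?m)"
    using q by (simp add: has_field_derivative_iff G_def)
  then have *: "((\<lambda>s. pochhammer s m / fact (m + 1) * G s * - inverse ((G s - 1) / (s + of_nat m)))
      \<longlongrightarrow> pochhammer ?m m / fact (m + 1) * G ?m * - inverse (of_real (ln q))) (at ?m)"
    unfolding G_def using q m
    by (intro tendsto_intros tendsto_pochhammer) auto
  have "eventually (\<lambda>s. s \<noteq> ?m) (at ?m)" by (simp add: eventually_at_filter)
  then have "eventually (\<lambda>s. pochhammer s m / fact (m + 1) * G s * - inverse ((G s - 1) / (s + of_nat m)) = qterm q (m + 1) s) (at ?m)"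
  proof eventually_elim
    case (elim s)
    then have "s + of_nat m \<noteq> 0" by (simp add: add_eq_0_iff2)
    then show ?case
      unfolding qterm_def G_def
      \<comment> \<open>If the power equals 1 at some s other than -m, both sides are 0 by the
        convention on division by 0.\<close>
      by (cases "of_real q powr (s + of_nat m) = (1 :: complex)")
         (simp_all add: pochhammer_Suc divide_simps, simp add: algebra_simps)
  qed
  with * have "qterm q (m + 1) \<midarrow>?m\<rightarrow> pochhammer ?m m / fact (m + 1) * G ?m * - inverse (of_real (ln q))"
    by (rule Lim_transform_eventually)
  also have "pochhammer ?m m / fact (m + 1) * G ?m * - inverse (of_real (ln q)) =
      of_real ((- 1) ^ (m + 1) / (real (m + 1) * ln q))"
    using q by (simp add: pochhammer_same G_def divide_simps)
  finally show ?thesis .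
qed

text \<open>At s = -m the exponent is the nonzero real r - m - 1, so the denominator does not vanish
  there.\<close>

lemma tendsto_qterm:
  assumes q: "0 < q" "q < 1" and "r \<noteq> m + 1"
  shows "qterm q r \<midarrow>- of_nat m\<rightarrow> qterm q r (- of_nat m)"
proof -
  let ?m = "- of_nat m :: complex"
  have "of_real q powr (?m + of_nat r - 1) = (of_real (q powr (- real m + real r - 1)) :: complex)"
    using q by (simp flip: powr_of_real)
  moreover have "q powr (- real m + real r - 1) \<noteq> 1"
    using q assms(3) by (auto simp: powr_eq_one_iff_gen)
  ultimately have "1 - of_real q powr (?m + of_nat r - 1) \<noteq> (0 :: complex)"
    by (metis eq_iff_diff_eq_0 of_real_eq_1_iff)
  then show ?thesis
    unfolding qterm_def using q by (intro tendsto_intros tendsto_pochhammer) auto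
qed

lemma qcont_tendsto_neg:
  assumes q: "0 < q" "q < 1"
  shows "qcont q \<midarrow>- of_nat m\<rightarrow> of_real
    (((\<Sum>r\<le>m. (- 1) ^ r * real (m choose r) / (q ^ (m + 1 - r) - 1)) +
      (- 1) ^ (m + 1) / (real (m + 1) * ln q)) / (1 - q) ^ m)"
proof -
  let ?m = "- of_nat m :: complex"
  \<comment> \<open>This is the norm of -m plus 3, the threshold of \<open>analytic_qtail\<close>.
    The index m + 2, left over below N, contributes 0 because its Pochhammer symbol vanishes at
    -m.\<close>
  define N where "N = m + 3"
  define c where "c = complex_of_real ((- 1) ^ (m + 1) / (real (m + 1) * ln q))"
  define T where "T s = (\<Sum>r. qterm q (r + N) s)" for s
  have "isCont T ?m"
    unfolding T_def by (rule analytic_at_imp_isCont[OF analytic_qtail[OF q]]) (simp add: N_def)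
  moreover have "T ?m = 0"
    unfolding T_def qterm_def by (simp add: pochhammer_of_nat_eq_0_lemma N_def)
  ultimately have T: "T \<midarrow>?m\<rightarrow> 0"
    by (simp add: isCont_def)
  \<comment> \<open>The limit of the term r = m + 1 is c, not its value at -m.\<close>
  have "(\<lambda>s. \<Sum>r<N. qterm q r s) \<midarrow>?m\<rightarrow> (\<Sum>r<N. if r = m + 1 then c else qterm q r ?m)"
    unfolding c_def using tendsto_qterm_exceptional[OF q, of m] tendsto_qterm[OF q, of _ m]
    by (intro tendsto_sum) auto
  moreover have "{..<N} = {..m} \<union> {m + 1, m + 2}" by (auto simp: N_def)
  then have "(\<Sum>r<N. if r = m + 1 then c else qterm q r ?m) = (\<Sum>r\<le>m. qterm q r ?m) + c"
    by (simp add: sum.union_disjoint) (simp add: qterm_def pochhammer_of_nat_eq_0_lemma)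
  moreover have "(\<lambda>s. of_real (1 - q) powr s) \<midarrow>?m\<rightarrow> of_real (1 - q) powr ?m"
    using analytic_at_imp_isCont[OF analytic_of_real_powr[of "1 - q"]] q by (simp add: isCont_def)
  ultimately have "qcont q \<midarrow>?m\<rightarrow> of_real (1 - q) powr ?m * ((\<Sum>r\<le>m. qterm q r ?m) + c + 0)"
    unfolding qcont_split[OF q, abs_def, of N] T_def[symmetric]
    using T by (intro tendsto_mult tendsto_add) auto
  also have "(\<Sum>r\<le>m. qterm q r ?m) = of_real (\<Sum>r\<le>m. (- 1) ^ r * real (m choose r) / (q ^ (m + 1 - r) - 1))"
    unfolding of_real_sum
  proof (rule sum.cong)
    fix r assume "r \<in> {..m}"
    then have r: "r \<le> m" by simp
    have 1: "pochhammer ?m r / fact r = of_real ((- 1) ^ r * real (m choose r))"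
    proof -
      have "of_real ((- 1) ^ r * real (m choose r)) = (- 1) ^ r * (of_nat m gchoose r :: complex)"
        by (simp add: binomial_gbinomial[where 'a = complex, symmetric])
      then show ?thesis by (simp add: gbinomial_pochhammer)
    qed
    have 2: "of_real q powr (?m + of_nat r - 1) = of_real (inverse (q ^ (m + 1 - r)))"
    proof -
      have "?m + of_nat r - 1 = - of_nat (m + 1 - r)"
        using r by (simp add: of_nat_diff)
      then show ?thesis using q by (simp add: powr_minus powr_nat')
    qed
    \<comment> \<open>Multiplying numerator and denominator by q^(m+1-r) turns the negative power
      into 1 / (q^(m+1-r) - 1).\<close>
    have "q ^ (m + 1 - r) < 1"
      using q r by (intro power_less_one_iff[THEN iffD2]) auto
    then have "(- 1) ^ r * real (m choose r) * (inverse (q ^ (m + 1 - r)) / (1 - inverse (q ^ (m + 1 - r))))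
        = (- 1) ^ r * real (m choose r) / (q ^ (m + 1 - r) - 1)"
      using q by (simp add: divide_simps)
    from arg_cong[OF this, of complex_of_real]
    show "qterm q r ?m = of_real ((- 1) ^ r * real (m choose r) / (q ^ (m + 1 - r) - 1))"
      unfolding qterm_def 1 2 by (simp only: of_real_mult of_real_divide of_real_diff of_real_1)
  qed simp
  also have "of_real (1 - q) powr ?m = of_real (inverse ((1 - q) ^ m))"
    using q by (simp add: powr_minus powr_nat')
  finally show ?thesis
    unfolding c_def by (simp add: field_simps)
qed

section \<open>Two alternating binomial sums\<close>

lemma alternating_binomial_power_sum:
  assumes "j \<le> m"
  shows "(\<Sum>r\<le>m. (- 1) ^ r * real (m choose r) * real (m + 1 - r) ^ j) = (if j = m then fact m else 0)"
proof -
  \<comment> \<open>compare coefficients in the binomial expansion of $e^X (e^X - 1)^m$\<close>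
  define H :: "real fps" where "H = fps_shift 1 (fps_exp 1 - 1)"
  define F :: "real fps" where "F = fps_exp 1 * (fps_exp 1 - 1) ^ m"
  have "fps_exp 1 - 1 = fps_X * H"
    unfolding H_def by (rule fps_ext) simp
  then have "F = fps_X ^ m * (fps_exp 1 * H ^ m)"
    unfolding F_def by (simp add: power_mult_distrib mult_ac)
  \<comment> \<open>H has constant coefficient 1, so F starts with X^m.\<close>
  then have "F $ j = (if j = m then 1 else 0)"
    using assms by (simp add: fps_X_power_mult_nth H_def fps_nth_power_0)
  moreover have "F = (\<Sum>r\<le>m. fps_const ((- 1) ^ r * real (m choose r)) * fps_exp (real (m + 1 - r)))"
  proof -
    have c: "of_nat (m choose r) * (- 1) ^ r = fps_const ((- 1) ^ r * real (m choose r))" for r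
    proof -
      have "(- 1 :: real fps) = fps_const (- 1)" by (simp flip: fps_const_neg)
      then have "of_nat (m choose r) * (- 1 :: real fps) ^ r = fps_const (real (m choose r)) * fps_const (- 1) ^ r"
        by (simp only: fps_of_nat)
      then show ?thesis by (simp only: fps_const_power fps_const_mult mult.commute)
    qed
    have "F = fps_exp 1 * (- 1 + fps_exp 1) ^ m"
      by (simp add: F_def)
    also have "\<dots> = fps_exp 1 * (\<Sum>r\<le>m. of_nat (m choose r) * (- 1) ^ r * fps_exp 1 ^ (m - r))"
      by (simp only: binomial_ring)
    also have "\<dots> = (\<Sum>r\<le>m. (of_nat (m choose r) * (- 1) ^ r) * fps_exp 1 ^ (m + 1 - r))"
      unfolding sum_distrib_left by (intro sum.cong) (simp_all add: Suc_diff_le mult_ac)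
    finally show ?thesis by (simp only: c fps_exp_power_mult mult_1_right)
  qed
  then have "F $ j = (\<Sum>r\<le>m. (- 1) ^ r * real (m choose r) * real (m + 1 - r) ^ j / fact j)"
    by (simp add: fps_sum_nth)
  ultimately show ?thesis
    by (simp flip: sum_divide_distrib split: if_splits)
qed

text \<open>Absorption turns the quotients into binomial coefficients of row m + 1. The full
  alternating sum of that row is 0, so omitting r = m + 1 leaves (-1)^m.\<close>

lemma alternating_binomial_reciprocal_sum:
  "(\<Sum>r\<le>m. (- 1) ^ r * real (m choose r) / real (m + 1 - r)) = (- 1) ^ m / real (m + 1)"
proof -
  have "(\<Sum>r\<le>m. (- 1) ^ r * real (m choose r) / real (m + 1 - r)) =
      (\<Sum>r\<le>m. (- 1) ^ r * real ((m + 1) choose r)) / real (m + 1)"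
    unfolding sum_divide_distrib
  proof (intro sum.cong refl)
    fix r assume "r \<in> {..m}"
    then have "(m + 1 - r) * ((m + 1) choose r) = (m + 1) * (m choose r)"
      using binomial_absorb_comp[of "m + 1" r] by simp
    then have "real (m + 1 - r) * real ((m + 1) choose r) = real (m + 1) * real (m choose r)"
      by (metis of_nat_mult)
    then have "real (m choose r) / real (m + 1 - r) = real ((m + 1) choose r) / real (m + 1)"
      using \<open>r \<in> {..m}\<close> by (subst frac_eq_eq) (simp, simp, metis mult.commute)
    then show "(- 1) ^ r * real (m choose r) / real (m + 1 - r) = (- 1) ^ r * real ((m + 1) choose r) / real (m + 1)"
      by (simp only: times_divide_eq_right[symmetric])
  qed
  also have "(\<Sum>r\<le>m. (- 1) ^ r * real ((m + 1) choose r)) = (- 1) ^ m"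
    using choose_alternating_sum[of "m + 1", where 'a = real] by simp
  finally show ?thesis .
qed

section \<open>Taylor expansion of the Bernoulli generating function\<close>

text \<open>After subtraction of the Taylor polynomial all coefficients up to order n vanish.
  Division by x^n therefore leaves a power series with constant coefficient 0, and its sum is
  continuous at 0.\<close>

lemma has_fps_expansion_Taylor_remainder:
  fixes f :: "'a :: {banach, real_normed_field} \<Rightarrow> 'a"
  assumes "f has_fps_expansion F"
  shows "((\<lambda>x. (f x - (\<Sum>j\<le>n. F $ j * x ^ j)) / x ^ n) \<longlongrightarrow> 0) (at 0)"
proof -
  define G where "G = F - (\<Sum>j\<le>n. fps_const (F $ j) * fps_X ^ j)"
  let ?g = "\<lambda>x. f x - (\<Sum>j\<le>n. F $ j * x ^ j)"
  have g: "?g has_fps_expansion G"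
    unfolding G_def by (intro fps_expansion_intros assms)
  have G0: "G $ i = 0" if "i \<le> n" for i
    using that by (simp add: G_def fps_sum_nth fps_X_power_nth if_distrib[of "(*) _"] sum.delta' cong: if_cong)
  have "((\<lambda>x. if x = 0 then 0 else ?g x / x ^ n) \<longlongrightarrow> 0) (at 0)"
  \<comment> \<open>The zero series has subdegree 0 by convention, so the shift argument does not
    cover it.\<close>
  proof (cases "G = 0")
    case True
    then have "eventually (\<lambda>x. ?g x = 0) (nhds 0)"
      using g by (auto simp: has_fps_expansion_def elim: eventually_mono)
    then have "eventually (\<lambda>x. (if x = 0 then 0 else ?g x / x ^ n) = 0) (at 0)"
      by (auto simp: eventually_at_filter elim: eventually_mono)
    then show ?thesis by (rule tendsto_eventually)
  next
    case False
    then have "n \<le> subdegree G"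
      using G0 by (meson nat_le_linear nth_subdegree_nonzero)
    then have "(\<lambda>x. if x = 0 then 0 else ?g x / x ^ n) has_fps_expansion fps_shift n G"
      using G0[of n] by (intro has_fps_expansion_shift g) auto
    then show ?thesis
      using has_fps_expansion_imp_continuous[of _ _ UNIV] by (fastforce simp: continuous_within)
  qed
  then show ?thesis
    by (rule Lim_transform_eventually) (auto simp: eventually_at_filter)
qed

definition bernoulli_fun :: "real \<Rightarrow> real" where
  "bernoulli_fun x = (if x = 0 then 1 else x * exp x / (exp x - 1))"

lemma bernoulli_fun_has_fps_expansion:
  "bernoulli_fun has_fps_expansion Abs_fps (\<lambda>k. bernoulli k / fact k)"
proof -
  have G: "subdegree (fps_exp (1 :: real) - 1) = 1"
    by (rule subdegreeI) auto
  have X: "subdegree (fps_X * fps_exp (1 :: real)) = 1"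
    by (rule subdegreeI) auto
  have "bernoulli_fun has_fps_expansion (fps_X * fps_exp 1 / (fps_exp 1 - 1))"
    unfolding bernoulli_fun_def[abs_def]
    by (intro has_fps_expansion_divide fps_expansion_intros) (use G in \<open>auto simp: X\<close>)
  also have "fps_X * fps_exp 1 / (fps_exp 1 - 1) = Abs_fps (\<lambda>k. bernoulli k / fact k)"
    by (rule fps_ext) (simp add: bernoulli_def)
  finally show ?thesis .
qed

lemma bernoulli_0: "bernoulli 0 = 1"
  using has_fps_expansion_imp_0_eq_fps_nth_0[OF bernoulli_fun_has_fps_expansion]
  by (simp add: bernoulli_fun_def)

text \<open>The Taylor remainder is scaled by x^n so that it is o(1) at 0.\<close>

definition bernoulli_rem :: "nat \<Rightarrow> real \<Rightarrow> real" where
  "bernoulli_rem n x = (bernoulli_fun x - (\<Sum>j\<le>n. bernoulli j / fact j * x ^ j)) / x ^ n"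

lemma tendsto_bernoulli_rem: "(bernoulli_rem n \<longlongrightarrow> 0) (at 0)"
  using has_fps_expansion_Taylor_remainder[OF bernoulli_fun_has_fps_expansion, of n]
  by (simp add: bernoulli_rem_def[abs_def])

text \<open>The left side is -g(x) / x with g = \<open>bernoulli_fun\<close>. Division by x shifts
  every index by one, and the coefficient B_0 = 1 becomes the polar part 1 / x.\<close>

lemma inverse_exp_minus_1_expansion:
  fixes x :: real
  assumes "x > 0"
  shows "1 / (exp (- x) - 1) = - (1 / x + (\<Sum>j\<le>m. bernoulli (j + 1) / fact (j + 1) * x ^ j)
    + bernoulli_rem (m + 1) x * x ^ m)"
proof -
  have "x * (1 / (exp (- x) - 1)) = - bernoulli_fun x"
    using assms by (simp add: bernoulli_fun_def exp_minus divide_simps) (simp add: algebra_simps)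
  also have "bernoulli_fun x = bernoulli_rem (m + 1) x * x ^ (m + 1) + (\<Sum>j\<le>m + 1. bernoulli j / fact j * x ^ j)"
    using assms by (simp add: bernoulli_rem_def)
  also have "(\<Sum>j\<le>m + 1. bernoulli j / fact j * x ^ j) =
      1 + (\<Sum>j\<le>m. bernoulli (j + 1) / fact (j + 1) * x ^ (j + 1))"
    by (simp only: Suc_eq_plus1[symmetric] sum.atMost_Suc_shift) (simp add: bernoulli_0)
  also have "\<dots> = x * (1 / x + (\<Sum>j\<le>m. bernoulli (j + 1) / fact (j + 1) * x ^ j))"
    using assms by (simp add: distrib_left sum_distrib_left mult_ac)
  also have "- (bernoulli_rem (m + 1) x * x ^ (m + 1) + x * y) = x * - (y + bernoulli_rem (m + 1) x * x ^ m)" for y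
    by (simp add: algebra_simps)
  finally show ?thesis
    using assms by (simp only: mult_left_cancel less_imp_neq[symmetric] simp_thms)
qed

section \<open>Asymptotics as q tends to 1\<close>

text \<open>The identity is exact for each q. It extracts the factor (-ln q)^m, which is to be
  compared with (1 - q)^m.\<close>

lemma alternating_sum_expansion:
  assumes q: "0 < q" "q < 1"
  shows "(\<Sum>r\<le>m. (- 1) ^ r * real (m choose r) / (q ^ (m + 1 - r) - 1)) + (- 1) ^ (m + 1) / (real (m + 1) * ln q)
    = - ((- ln q) ^ m * (bernoulli (m + 1) / real (m + 1)
        + (\<Sum>r\<le>m. (- 1) ^ r * real (m choose r) * real (m + 1 - r) ^ m
              * bernoulli_rem (m + 1) (real (m + 1 - r) * - ln q))))"
proof -
  define t where "t = - ln q"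
  have t: "t > 0" "ln q = - t" "q = exp (- t)" using q by (auto simp: t_def)
  define a where "a r = (- 1) ^ r * real (m choose r)" for r
  define k where "k r = real (m + 1 - r)" for r
  define b where "b j = bernoulli (j + 1) / fact (j + 1)" for j
  have "a r / (q ^ (m + 1 - r) - 1) =
      - (a r / k r / t + (\<Sum>j\<le>m. b j * t ^ j * (a r * k r ^ j)) + a r * k r ^ m * bernoulli_rem (m + 1) (k r * t) * t ^ m)"
    if "r \<le> m" for r
  proof -
    have "q ^ (m + 1 - r) = exp (- (k r * t))"
      by (simp add: t(3) k_def exp_of_nat_mult[symmetric])
    moreover have "k r * t > 0" using that t by (simp add: k_def)
    ultimately have "a r / (q ^ (m + 1 - r) - 1) = a r * - (1 / (k r * t) + (\<Sum>j\<le>m. b j * (k r * t) ^ j)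
        + bernoulli_rem (m + 1) (k r * t) * (k r * t) ^ m)"
      using inverse_exp_minus_1_expansion[of "k r * t" m] by (simp add: b_def divide_inverse)
    moreover have "a r * (\<Sum>j\<le>m. b j * (k r * t) ^ j) = (\<Sum>j\<le>m. b j * t ^ j * (a r * k r ^ j))"
      by (simp only: sum_distrib_left power_mult_distrib mult_ac)
    moreover have "x * - (1 / (y * t) + z + w * (y * t) ^ m) = - (x / y / t + x * z + x * y ^ m * w * t ^ m)"
      for x y z w :: real
      by (simp add: power_mult_distrib right_diff_distrib mult_ac)
    ultimately show ?thesis
      by (simp only:)
  qed
  then have "(\<Sum>r\<le>m. a r / (q ^ (m + 1 - r) - 1)) =
     (\<Sum>r\<le>m. - (a r / k r / t + (\<Sum>j\<le>m. b j * t ^ j * (a r * k r ^ j)) + a r * k r ^ m * bernoulli_rem (m + 1) (k r * t) * t ^ m))"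
    by (intro sum.cong) auto
  also have "\<dots> = - ((\<Sum>r\<le>m. a r / k r) / t + (\<Sum>r\<le>m. \<Sum>j\<le>m. b j * t ^ j * (a r * k r ^ j))
      + (\<Sum>r\<le>m. a r * k r ^ m * bernoulli_rem (m + 1) (k r * t)) * t ^ m)"
    by (simp add: sum_negf sum.distrib sum_divide_distrib sum_distrib_right sum_subtractf)
  also have "(\<Sum>r\<le>m. \<Sum>j\<le>m. b j * t ^ j * (a r * k r ^ j)) = (\<Sum>j\<le>m. b j * t ^ j * (\<Sum>r\<le>m. a r * k r ^ j))"
    by (subst sum.swap) (simp add: sum_distrib_left)
  \<comment> \<open>Only j = m survives, with m! from the power sum against (m + 1)! in b m.\<close>
  also have "\<dots> = (\<Sum>j\<le>m. if j = m then b m * t ^ m * fact m else 0)"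
    unfolding a_def k_def using alternating_binomial_power_sum[of _ m] by (intro sum.cong) auto
  also have "\<dots> = bernoulli (m + 1) / real (m + 1) * t ^ m"
    by (simp add: b_def)
  also have "(\<Sum>r\<le>m. a r / k r) = (- 1) ^ m / real (m + 1)"
    unfolding a_def k_def by (rule alternating_binomial_reciprocal_sum)
  finally have E: "(\<Sum>r\<le>m. a r / (q ^ (m + 1 - r) - 1)) = - ((- 1) ^ m / real (m + 1) / t +
      bernoulli (m + 1) / real (m + 1) * t ^ m +
      (\<Sum>r\<le>m. a r * k r ^ m * bernoulli_rem (m + 1) (k r * t)) * t ^ m)" .
  have *: "- (x + y * w + d * w) + x = - (w * (y + d))" for x y w d :: real
    by (simp add: algebra_simps)
  \<comment> \<open>The exceptional term is the opposite of the polar contribution, so the two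
    cancel.\<close>
  have "(- 1) ^ (m + 1) / (real (m + 1) * - t) = (- 1) ^ m / real (m + 1) / t"
    by simp
  then show ?thesis
    unfolding t(2) a_def[symmetric] k_def[symmetric] E minus_minus
    using *[of "(- 1) ^ m / real (m + 1) / t"] by (simp only:)
qed

lemma tendsto_alternating_sum:
  "((\<lambda>q. ((\<Sum>r\<le>m. (- 1) ^ r * real (m choose r) / (q ^ (m + 1 - r) - 1)) +
        (- 1) ^ (m + 1) / (real (m + 1) * ln q)) / (1 - q) ^ m)
     \<longlongrightarrow> - bernoulli (m + 1) / real (m + 1)) (at_left 1)"
proof -
  \<comment> \<open>The derivative of ln at 1 shows that -ln q / (1 - q) tends to 1.\<close>
  have "((\<lambda>q. (ln q - ln 1) / (q - 1)) \<longlongrightarrow> 1) (at_left (1 :: real))"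
    using DERIV_ln[of "1 :: real"] by (auto simp: has_field_derivative_iff intro: filterlim_mono at_le)
  then have A: "((\<lambda>q. - (((ln q - ln 1) / (q - 1)) ^ m) * (bernoulli (m + 1) / real (m + 1)
        + (\<Sum>r\<le>m. (- 1) ^ r * real (m choose r) * real (m + 1 - r) ^ m
              * bernoulli_rem (m + 1) (real (m + 1 - r) * - ln q))))
      \<longlongrightarrow> - (1 ^ m) * (bernoulli (m + 1) / real (m + 1)
        + (\<Sum>r\<le>m. (- 1) ^ r * real (m choose r) * real (m + 1 - r) ^ m * 0))) (at_left (1 :: real))"
  proof (intro tendsto_intros)
    fix r assume "r \<in> {..m}"
    then have k: "real (m + 1 - r) \<noteq> 0" by simp
    have "((\<lambda>q. real (m + 1 - r) * - ln q) \<longlongrightarrow> real (m + 1 - r) * - ln 1) (at_left (1 :: real))"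
      by (intro tendsto_intros) auto
    \<comment> \<open>The remainder tends to 0 along the punctured filter at 0, so its argument has
      to stay nonzero; q < 1 ensures this.\<close>
    moreover have "eventually (\<lambda>q. 0 < q \<and> q < 1) (at_left (1 :: real))"
      using eventually_at_left_real[of 0 1] by simp
    then have "eventually (\<lambda>q. real (m + 1 - r) * - ln q \<noteq> 0) (at_left (1 :: real))"
      by eventually_elim (use k in auto)
    ultimately have "filterlim (\<lambda>q. real (m + 1 - r) * - ln q) (at 0) (at_left (1 :: real))"
      by (simp add: filterlim_at)
    then show "((\<lambda>q. bernoulli_rem (m + 1) (real (m + 1 - r) * - ln q)) \<longlongrightarrow> 0) (at_left 1)"
      by (rule filterlim_compose[OF tendsto_bernoulli_rem])
  qed
  have "eventually (\<lambda>q. 0 < q \<and> q < 1) (at_left (1 :: real))"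
    using eventually_at_left_real[of 0 1] by simp
  then have "eventually (\<lambda>q. - (((ln q - ln 1) / (q - 1)) ^ m) * (bernoulli (m + 1) / real (m + 1)
        + (\<Sum>r\<le>m. (- 1) ^ r * real (m choose r) * real (m + 1 - r) ^ m
              * bernoulli_rem (m + 1) (real (m + 1 - r) * - ln q))) =
      ((\<Sum>r\<le>m. (- 1) ^ r * real (m choose r) / (q ^ (m + 1 - r) - 1)) +
        (- 1) ^ (m + 1) / (real (m + 1) * ln q)) / (1 - q) ^ m) (at_left (1 :: real))"
  proof eventually_elim
    case (elim q)
    have "(ln q - ln 1) / (q - 1) = (- ln q) / (1 - q)"
      by (metis ln_one diff_0_right minus_diff_eq minus_divide_divide)
    then have 1: "((ln q - ln 1) / (q - 1)) ^ m = (- ln q) ^ m / (1 - q) ^ m"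
      by (simp only: power_divide)
    have 2: "- (a / b) * x = - (a * x) / b" for a b x :: real
      by simp
    show ?case
      unfolding 1 2 alternating_sum_expansion[OF conjunct1[OF elim] conjunct2[OF elim]] ..
  qed
  from Lim_transform_eventually[OF A this] show ?thesis by simp
qed

theorem theorem1:
  fixes m :: nat
  shows "(\<forall>q::real. 0 < q \<and> q < 1 \<longrightarrow> (\<exists>l. (qzeta q \<longlongrightarrow> l) (at (- of_nat m)))) \<and>
         ((\<lambda>q::real. Lim (at (- of_nat m)) (qzeta q))
            \<longlongrightarrow> of_real (- bernoulli (m + 1) / real (m + 1))) (at_left 1)"
proof (intro conjI allI impI)
  define L where "L q = ((\<Sum>r\<le>m. (- 1) ^ r * real (m choose r) / (q ^ (m + 1 - r) - 1)) +
      (- 1) ^ (m + 1) / (real (m + 1) * ln q)) / (1 - q) ^ m" for q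
  have lim: "qzeta q \<midarrow>- of_nat m\<rightarrow> of_real (L q)" if "0 < q" "q < 1" for q
    unfolding L_def using that by (intro tendsto_qzeta qcont_tendsto_neg)
  then show "\<exists>l. (qzeta q \<longlongrightarrow> l) (at (- of_nat m))" if "0 < q \<and> q < 1" for q
    using that by blast
  have "((\<lambda>q. complex_of_real (L q)) \<longlongrightarrow> of_real (- bernoulli (m + 1) / real (m + 1))) (at_left 1)"
    unfolding L_def by (intro tendsto_of_real tendsto_alternating_sum)
  \<comment> \<open>\<open>Lim\<close> is a description and gives the limit only where one exists,
    which is known for q between 0 and 1; this suffices to the left of 1.\<close>
  moreover have "eventually (\<lambda>q. of_real (L q) = Lim (at (- of_nat m)) (qzeta q)) (at_left 1)"
    using eventually_at_left_real[of 0 1, simplified]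
    by eventually_elim (auto intro!: tendsto_Lim[symmetric] lim)
  ultimately show "((\<lambda>q. Lim (at (- of_nat m)) (qzeta q))
      \<longlongrightarrow> of_real (- bernoulli (m + 1) / real (m + 1))) (at_left 1)"
    by (rule Lim_transform_eventually)
qed

end
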